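(* Let $A$ be an infinite dimensional simple unital C*-algebra, and let $B \subset A$ be a large subalgebra. Then $B$ is simple.
   Context: Subalgebras are C*-subalgebras; a unital subalgebra of $A$ contains the identity of $A$. For a C*-algebra $D$ and $a, b \in D_{+}$ (positive elements), $a \precsim_D b$ (Cuntz subequivalence) means there is a sequence $(v_n)$ in $D$ with $\lim_{n \to \infty} v_n b v_n^* = a$. Large subalgebra: let $A$ be an infinite dimensional simple unital C*-algebra. A unital subalgebra $B \subset A$ is large in $A$ if for every integer $m \geq 1$, $a_1, \ldots, a_m \in A$, $\varepsilon > 0$, $x \in A_{+}$ with $\|x\| = 1$, and $y \in B_{+} \setminus \{0\}$, there are $c_1, \ldots, c_m \in A$ and $g \in B$ such that: (1) $0 \leq g \leq 1$; (2) $\|c_j - a_j\| < \varepsilon$ for $j = 1, \ldots, m$; (3) $(1-g) c_j \in B$ for $j = 1, \ldots, m$; (4) $g \precsim_B y$ and $g \precsim_A x$; (5) $\|(1-g) x (1-g)\| > 1 - \varepsilon$. *)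

theory Defs
  imports "HOL-Analysis.Analysis"
begin

(* Unital C*-algebras. The zero algebra is excluded by the superclass real_normed_algebra_1;
   its further axiom norm 1 = 1 holds in every nonzero unital C*-algebra. *)
class unital_cstar_algebra = real_normed_algebra_1 + banach +
  fixes scaleC :: "complex \<Rightarrow> 'a \<Rightarrow> 'a"  (infixr "*\<^sub>C" 75)
    and adj :: "'a \<Rightarrow> 'a"
  assumes scaleC_add_right: "c *\<^sub>C (x + y) = c *\<^sub>C x + c *\<^sub>C y"
    and scaleC_add_left: "(c + d) *\<^sub>C x = c *\<^sub>C x + d *\<^sub>C x"
    and scaleC_scaleC: "c *\<^sub>C (d *\<^sub>C x) = (c * d) *\<^sub>C x"
    and scaleR_scaleC: "scaleR r x = complex_of_real r *\<^sub>C x"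
    and mult_scaleC_left: "(c *\<^sub>C x) * y = c *\<^sub>C (x * y)"
    and mult_scaleC_right: "x * (c *\<^sub>C y) = c *\<^sub>C (x * y)"
    and norm_scaleC: "norm (c *\<^sub>C x) = cmod c * norm x"
    and adj_adj: "adj (adj x) = x"
    and adj_add: "adj (x + y) = adj x + adj y"
    and adj_scaleC: "adj (c *\<^sub>C x) = cnj c *\<^sub>C adj x"
    and adj_mult: "adj (x * y) = adj y * adj x"
    and cstar_identity: "norm (adj x * x) = norm x ^ 2"

lemma vector_space_scaleC:
  "vector_space (scaleC :: complex \<Rightarrow> 'a \<Rightarrow> 'a :: unital_cstar_algebra)"
proof
  fix x :: 'a
  have "1 *\<^sub>C x = scaleR 1 x" by (simp only: scaleR_scaleC of_real_1)
  then show "1 *\<^sub>C x = x" by simp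
qed (simp_all add: scaleC_add_right scaleC_add_left scaleC_scaleC)

definition finite_dimensional :: "'a :: unital_cstar_algebra set \<Rightarrow> bool" where
  "finite_dimensional V \<longleftrightarrow> (\<exists>S. finite S \<and> module.span scaleC S = V)"

(* The ambient algebra A is the whole type; subalgebras are subsets of it, and A itself as an
   algebra is UNIV. *)
definition cstar_subalgebra :: "'a :: unital_cstar_algebra set \<Rightarrow> bool" where
  "cstar_subalgebra D \<longleftrightarrow> module.subspace scaleC D \<and> closed D \<and>
     (\<forall>x\<in>D. \<forall>y\<in>D. x * y \<in> D) \<and> (\<forall>x\<in>D. adj x \<in> D)"

definition unital_cstar_subalgebra :: "'a :: unital_cstar_algebra set \<Rightarrow> bool" where
  "unital_cstar_subalgebra D \<longleftrightarrow> cstar_subalgebra D \<and> 1 \<in> D"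

definition closed_ideal :: "'a :: unital_cstar_algebra set \<Rightarrow> 'a set \<Rightarrow> bool" where
  "closed_ideal D I \<longleftrightarrow> I \<subseteq> D \<and> module.subspace scaleC I \<and> closed I \<and>
     (\<forall>d\<in>D. \<forall>x\<in>I. d * x \<in> I \<and> x * d \<in> I)"

definition simple_cstar :: "'a :: unital_cstar_algebra set \<Rightarrow> bool" where
  "simple_cstar D \<longleftrightarrow> D \<noteq> {0} \<and> (\<forall>I. closed_ideal D I \<longrightarrow> I = {0} \<or> I = D)"

(* Spectrum relative to D, meaningful for D containing the identity. *)
definition spectrum_in :: "'a :: unital_cstar_algebra set \<Rightarrow> 'a \<Rightarrow> complex set" where
  "spectrum_in D a =
     {z. \<not> (\<exists>b\<in>D. b * (a - z *\<^sub>C 1) = 1 \<and> (a - z *\<^sub>C 1) * b = 1)}"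

definition positives :: "'a :: unital_cstar_algebra set \<Rightarrow> 'a set" where
  "positives D = {a \<in> D. adj a = a \<and> (\<forall>z\<in>spectrum_in D a. z \<in> \<real> \<and> 0 \<le> Re z)}"

(* Used only for positive elements a, b of D. *)
definition cuntz_subeq :: "'a :: unital_cstar_algebra set \<Rightarrow> 'a \<Rightarrow> 'a \<Rightarrow> bool" where
  "cuntz_subeq D a b \<longleftrightarrow>
     (\<exists>v. (\<forall>n. v n \<in> D) \<and> (\<lambda>n::nat. v n * b * adj (v n)) \<longlonglongrightarrow> a)"

(* B is large in the ambient algebra UNIV. The condition 0 <= g <= 1 is read in B. *)
definition large_subalgebra :: "'a :: unital_cstar_algebra set \<Rightarrow> bool" where
  "large_subalgebra B \<longleftrightarrow> unital_cstar_subalgebra B \<and>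
     (\<forall>(m::nat) (a :: nat \<Rightarrow> 'a) (\<epsilon>::real) x y.
        m \<ge> 1 \<longrightarrow> \<epsilon> > 0 \<longrightarrow> x \<in> positives UNIV \<longrightarrow> norm x = 1 \<longrightarrow>
        y \<in> positives B - {0} \<longrightarrow>
        (\<exists>(c :: nat \<Rightarrow> 'a) g. g \<in> B \<and>
           g \<in> positives B \<and> 1 - g \<in> positives B \<and>
           (\<forall>j\<in>{1..m}. norm (c j - a j) < \<epsilon>) \<and>
           (\<forall>j\<in>{1..m}. (1 - g) * c j \<in> B) \<and>
           cuntz_subeq B g y \<and> cuntz_subeq UNIV g x \<and>
           norm ((1 - g) * x * (1 - g)) > 1 - \<epsilon>))"

end

theory Submission
  imports Defs
begin

text \<open>Let \<open>I\<close> be a nonzero closed ideal of \<open>B\<close> and \<open>y\<close> a nonzero positive element of \<open>I\<close>. Since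
  \<open>A\<close> is simple, some finite sum \<open>z\<close> of elements \<open>p * y * q\<close> with \<open>p, q\<close> in \<open>A\<close> is close to \<open>1\<close>.
  Largeness replaces the \<open>p\<close> and \<open>adj q\<close> by nearby \<open>c\<close> with \<open>(1 - g) * c\<close> in \<open>B\<close>, where \<open>g\<close> is
  Cuntz below \<open>y\<close> in \<open>B\<close> and therefore lies in \<open>I\<close>. With \<open>h = 1 - g\<close>, both \<open>h * z * h\<close> and
  \<open>1 - h * h = g + g * h\<close> are in \<open>I\<close>, and their sum is close to \<open>1\<close> because \<open>norm h \<le> 1\<close>.

  The bound on \<open>norm h\<close> requires that a self-adjoint element has a spectral value of modulus equal
  to its norm. In place of the spectral radius formula via complex analysis, the resolvents of the
  powers \<open>u ^ 2 ^ m\<close> are compared at \<open>w\<close> and at a slightly smaller multiple of \<open>w\<close>.\<close>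

section \<open>The involution, and closure properties of subalgebras\<close>

interpretation cvs: vector_space "scaleC :: complex \<Rightarrow> 'a \<Rightarrow> 'a :: unital_cstar_algebra"
  by (rule vector_space_scaleC)

lemma norm_adj [simp]: "norm (adj x) = norm (x :: 'a :: unital_cstar_algebra)"
proof -
  have le: "norm y \<le> norm (adj y)" for y :: 'a
  proof (cases "norm y = 0")
    case False
    have "norm y * norm y \<le> norm (adj y) * norm y"
      using cstar_identity[of y] norm_mult_ineq[of "adj y" y] by (simp add: power2_eq_square)
    then show ?thesis using False by simp
  qed simp
  show ?thesis using le[of x] le[of "adj x"] by (simp add: adj_adj)
qed

lemma adj_0 [simp]: "adj (0 :: 'a :: unital_cstar_algebra) = 0"
  by (metis norm_adj norm_eq_zero)

lemma adj_1 [simp]: "adj (1 :: 'a :: unital_cstar_algebra) = 1"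
  using adj_mult[of "1 :: 'a" "adj 1"] by (simp add: adj_adj)

lemma adj_diff: "adj (x - y) = adj x - adj (y :: 'a :: unital_cstar_algebra)"
  using adj_add[of "x - y" y] by simp

lemma tendsto_adj:
  fixes f :: "'b \<Rightarrow> 'a :: unital_cstar_algebra"
  assumes "(f \<longlongrightarrow> l) F"
  shows "((\<lambda>n. adj (f n)) \<longlongrightarrow> adj l) F"
  using assms by (simp add: tendsto_iff dist_norm flip: adj_diff)

lemma subalgebra_closed:
  assumes "unital_cstar_subalgebra B"
  shows "closed B" "1 \<in> B" "0 \<in> B"
    "\<And>x y. x \<in> B \<Longrightarrow> y \<in> B \<Longrightarrow> x + y \<in> B" "\<And>x y. x \<in> B \<Longrightarrow> y \<in> B \<Longrightarrow> x - y \<in> B"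
    "\<And>c x. x \<in> B \<Longrightarrow> c *\<^sub>C x \<in> B"
    "\<And>x y. x \<in> B \<Longrightarrow> y \<in> B \<Longrightarrow> x * y \<in> B" "\<And>x. x \<in> B \<Longrightarrow> adj x \<in> B"
  using assms unfolding unital_cstar_subalgebra_def cstar_subalgebra_def
  by (auto simp: cvs.subspace_0 cvs.subspace_add cvs.subspace_diff cvs.subspace_scale)

lemma unital_cstar_subalgebra_UNIV: "unital_cstar_subalgebra UNIV"
  by (simp add: unital_cstar_subalgebra_def cstar_subalgebra_def)

section \<open>Inverses and the spectrum\<close>

definition inverse_pair :: "'a :: monoid_mult \<Rightarrow> 'a \<Rightarrow> bool" where
  "inverse_pair a b \<longleftrightarrow> a * b = 1 \<and> b * a = 1"

lemma inverse_pair_mult: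
  "inverse_pair a b \<Longrightarrow> inverse_pair c d \<Longrightarrow> inverse_pair (a * c) (d * b)"
  unfolding inverse_pair_def by (metis mult.assoc mult.left_neutral)

lemma inverse_pair_scaleC:
  assumes "inverse_pair a b" "c \<noteq> 0"
  shows "inverse_pair (c *\<^sub>C a) (inverse c *\<^sub>C b)"
  using assms
  by (simp add: inverse_pair_def mult_scaleC_left mult_scaleC_right scaleC_scaleC)

lemma notin_spectrum_in_iff:
  "z \<notin> spectrum_in D a \<longleftrightarrow> (\<exists>b\<in>D. inverse_pair (a - z *\<^sub>C 1) b)"
  unfolding spectrum_in_def inverse_pair_def by auto

text \<open>The partial sums of the geometric series lie in \<open>B\<close> and \<open>B\<close> is
  closed, so the inverse stays in \<open>B\<close>. This makes the estimate usable for spectra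
  relative to \<open>B\<close>.\<close>

lemma neumann_inverse:
  fixes x :: "'a :: unital_cstar_algebra"
  assumes B: "unital_cstar_subalgebra B" and x: "x \<in> B" "norm x < 1"
  obtains b where "b \<in> B" "inverse_pair (1 - x) b"
proof -
  define b where "b = (\<Sum>n. x ^ n)"
  have sm: "summable (\<lambda>n. x ^ n)"
    using x(2) by (rule complete_algebra_summable_geometric)
  have pow: "x ^ n \<in> B" for n
    by (induction n) (use B x in \<open>auto intro: subalgebra_closed\<close>)
  have "(\<Sum>n<k. x ^ n) \<in> B" for k
    by (induction k) (use B pow in \<open>auto intro: subalgebra_closed\<close>)
  moreover have "(\<lambda>k. \<Sum>n<k. x ^ n) \<longlonglongrightarrow> b"
    unfolding b_def using sm by (rule summable_LIMSEQ)
  ultimately have "b \<in> B"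
    by (rule closed_sequentially[OF subalgebra_closed(1)[OF B]])
  moreover have "b = 1 + (\<Sum>n. x ^ Suc n)"
    unfolding b_def using suminf_split_head[OF sm] by simp
  moreover have "(\<Sum>n. x ^ Suc n) = x * b"
    unfolding b_def using suminf_mult[OF sm, of x] by simp
  moreover have "(\<Sum>n. x ^ Suc n) = b * x"
    unfolding b_def using suminf_mult2[OF sm, of x] by (simp add: power_commutes)
  ultimately show thesis
    by (intro that[of b]) (auto simp: inverse_pair_def algebra_simps)
qed

text \<open>For \<open>cmod z > norm x\<close>, factor \<open>x - z\<close> as \<open>- z\<close>
  times \<open>1 - x / z\<close> and invert the second factor by a Neumann series.\<close>

lemma spectrum_in_norm_le:
  fixes x :: "'a :: unital_cstar_algebra"
  assumes B: "unital_cstar_subalgebra B" and x: "x \<in> B" and z: "z \<in> spectrum_in B x"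
  shows "cmod z \<le> norm x"
proof (rule ccontr)
  assume "\<not> ?thesis"
  then have z0: "z \<noteq> 0" and "norm (inverse z *\<^sub>C x) < 1"
    by (auto simp: norm_scaleC norm_divide inverse_eq_divide divide_simps)
  then obtain b where b: "b \<in> B" "inverse_pair (1 - inverse z *\<^sub>C x) b"
    using neumann_inverse[OF B, of "inverse z *\<^sub>C x"] subalgebra_closed(6)[OF B x] by metis
  have "inverse_pair ((- z) *\<^sub>C (1 - inverse z *\<^sub>C x)) (inverse (- z) *\<^sub>C b)"
    using b z0 by (intro inverse_pair_scaleC) auto
  moreover have "(- z) *\<^sub>C (1 - inverse z *\<^sub>C x) = x - z *\<^sub>C 1"
    using z0 by (simp add: cvs.scale_right_diff_distrib scaleC_scaleC)
  ultimately show False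
    using z b(1) subalgebra_closed(6)[OF B] notin_spectrum_in_iff by metis
qed

lemma spectrum_in_shift:
  "z + c \<in> spectrum_in D (a + c *\<^sub>C 1) \<longleftrightarrow> z \<in> spectrum_in D a"
  by (simp add: spectrum_in_def scaleC_add_left)

text \<open>Arens' trick: shifting by \<open>it\<close> moves a spectral value with nonzero imaginary part
  faster than it increases the norm.\<close>
lemma selfadjoint_spectrum_real:
  fixes x :: "'a :: unital_cstar_algebra"
  assumes B: "unital_cstar_subalgebra B" and x: "x \<in> B" "adj x = x"
    and z: "z \<in> spectrum_in B x"
  shows "Im z = 0"
proof (rule ccontr)
  assume nz: "Im z \<noteq> 0"
  \<comment> \<open>This \<open>t\<close> makes \<open>2 * t * Im z\<close> exceed
    \<open>(norm x)\<^sup>2\<close> by exactly \<open>1\<close>.\<close>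
  define t where "t = ((norm x)\<^sup>2 + 1) / (2 * Im z)"
  define c where "c = \<i> * complex_of_real t"
  have "cmod (z + c) \<le> norm (x + c *\<^sub>C 1)"
    using B x z by (intro spectrum_in_norm_le) (auto simp: spectrum_in_shift intro: subalgebra_closed)
  then have "(cmod (z + c))\<^sup>2 \<le> norm (adj (x + c *\<^sub>C 1) * (x + c *\<^sub>C 1))"
    by (simp add: cstar_identity power_mono)
  also have "adj (x + c *\<^sub>C 1) * (x + c *\<^sub>C 1) = x * x + (t\<^sup>2) *\<^sub>R 1"
  proof -
    have "c * c = - complex_of_real (t\<^sup>2)" "cnj c = - c"
      by (auto simp: c_def complex_eq_iff power2_eq_square)
    then show ?thesis
      by (simp add: adj_add adj_scaleC x algebra_simps mult_scaleC_left
          mult_scaleC_right scaleC_scaleC scaleR_scaleC)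
  qed
  also have "norm \<dots> \<le> (norm x)\<^sup>2 + t\<^sup>2"
    by (rule norm_triangle_le) (simp add: power2_eq_square norm_mult_ineq)
  finally have "(Re z)\<^sup>2 + (Im z)\<^sup>2 + 2 * t * Im z \<le> (norm x)\<^sup>2"
    by (simp add: cmod_power2 c_def power2_sum mult_ac)
  moreover have "2 * t * Im z = (norm x)\<^sup>2 + 1"
    using nz by (simp add: t_def)
  ultimately show False
    using sum_power2_ge_zero[of "Re z" "Im z"] by linarith
qed

text \<open>If \<open>z\<close> is not a nonnegative real, its square root \<open>w\<close> is not
  real, so \<open>x - w\<close> and \<open>x + w\<close> are invertible in \<open>B\<close>. Hence
  so is their product \<open>x * x - z\<close>.\<close>

lemma square_in_positives:
  assumes B: "unital_cstar_subalgebra B" and x: "x \<in> B" "adj x = x"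
  shows "x * x \<in> positives B"
proof -
  have "z \<in> \<real> \<and> 0 \<le> Re z" if z: "z \<in> spectrum_in B (x * x)" for z
  proof (rule ccontr)
    assume neg: "\<not> ?thesis"
    define w where "w = csqrt z"
    have w2: "w * w = z" by (simp add: w_def flip: power2_eq_square)
    have "Im w \<noteq> 0"
    proof
      assume "Im w = 0"
      then have "Im z = 0" "0 \<le> Re z" using w2 by auto
      then show False using neg by (simp add: complex_is_Real_iff)
    qed
    then have "w \<notin> spectrum_in B x" "- w \<notin> spectrum_in B x"
      using selfadjoint_spectrum_real[OF B x] by fastforce+
    then obtain b b' where b: "b \<in> B" "inverse_pair (x - w *\<^sub>C 1) b"
      and b': "b' \<in> B" "inverse_pair (x - (- w) *\<^sub>C 1) b'"
      unfolding notin_spectrum_in_iff by blast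
    have "(x - w *\<^sub>C 1) * (x - (- w) *\<^sub>C 1) = x * x - z *\<^sub>C 1"
      by (simp add: algebra_simps mult_scaleC_left mult_scaleC_right scaleC_scaleC w2)
    then have "inverse_pair (x * x - z *\<^sub>C 1) (b' * b)"
      using inverse_pair_mult[OF b(2) b'(2)] by simp
    then show False
      using z b(1) b'(1) subalgebra_closed(7)[OF B] notin_spectrum_in_iff by blast
  qed
  then show ?thesis
    using B x by (auto simp: positives_def adj_mult intro: subalgebra_closed)
qed

lemma one_in_positives:
  assumes "unital_cstar_subalgebra B" shows "1 \<in> positives B"
  using square_in_positives[OF assms, of 1] subalgebra_closed(2)[OF assms] by simp

section \<open>The norm of a self-adjoint element\<close>

text \<open>Write \<open>a' = a * (1 - x)\<close> with \<open>x = b * (a - a')\<close>, whose norm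
  is at most 1/2. The inverse \<open>n\<close> of \<open>1 - x\<close> then has norm at most 2, and
  \<open>n * b - b = n * x * b\<close> gives the explicit rate.\<close>

lemma inverse_perturbation:
  fixes a :: "'a :: unital_cstar_algebra"
  assumes ab: "inverse_pair a b" and b: "norm b \<le> C" and d: "norm (a' - a) \<le> \<delta>"
    and small: "C * \<delta> \<le> 1 / 2"
  obtains b' where "inverse_pair a' b'" "norm (b' - b) \<le> 2 * C\<^sup>2 * \<delta>"
proof -
  define x where "x = b * (a - a')"
  have C0: "0 \<le> C" using b norm_ge_zero order_trans by blast
  have "norm x \<le> norm b * norm (a' - a)"
    unfolding x_def by (metis norm_mult_ineq norm_minus_commute)
  also have "\<dots> \<le> C * \<delta>" using b d C0 by (intro mult_mono) auto
  finally have nx: "norm x \<le> C * \<delta>" .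
  then have "norm x < 1" using small by simp
  then obtain n where n: "inverse_pair (1 - x) n"
    using neumann_inverse[OF unital_cstar_subalgebra_UNIV, of x] by auto
  have "a * (1 - x) = a'"
    using ab unfolding inverse_pair_def x_def
    by (simp add: right_diff_distrib mult.assoc[symmetric])
  then have inv: "inverse_pair a' (n * b)"
    using inverse_pair_mult[OF ab n] by simp
  have n1: "n = 1 + n * x"
    using n by (simp add: inverse_pair_def algebra_simps)
  have "norm n \<le> 1 + norm n * norm x"
    by (subst n1) (metis norm_triangle_le norm_one norm_mult_ineq add_left_mono)
  also have "\<dots> \<le> 1 + norm n * (1 / 2)"
    using nx small by (intro add_left_mono mult_left_mono) auto
  finally have nn: "norm n \<le> 2" by simp
  have "n * b - b = n * x * b"
    by (subst n1) (simp add: algebra_simps)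
  then have "norm (n * b - b) \<le> norm n * norm x * norm b"
    by (metis norm_mult_ineq mult_right_mono norm_ge_zero order_trans)
  also have "\<dots> \<le> 2 * (C * \<delta>) * C"
    using nn nx b C0 by (intro mult_mono) (auto intro: order_trans[OF norm_ge_zero])
  finally show thesis
    using that[OF inv] by (simp add: power2_eq_square mult_ac)
qed

text \<open>Compactness of the circle: near each point \<open>inverse_perturbation\<close> bounds
  the resolvent, and finitely many such neighbourhoods suffice.\<close>

lemma resolvent_bounded_on_circle:
  fixes u :: "'a :: unital_cstar_algebra"
  assumes u: "norm u \<le> 1"
    and inv: "\<And>w. cmod w = 1 \<Longrightarrow> \<exists>b. inverse_pair (1 - w *\<^sub>C u) b"
  obtains C where "1 \<le> C" "\<And>w. cmod w = 1 \<Longrightarrow> \<exists>b. inverse_pair (1 - w *\<^sub>C u) b \<and> norm b \<le> C"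
proof -
  obtain R where R: "\<And>w. cmod w = 1 \<Longrightarrow> inverse_pair (1 - w *\<^sub>C u) (R w)"
    using inv by metis
  \<comment> \<open>With \<open>c = norm (R w) + 1\<close>, this gives
    \<open>c * r w = 1 / 2\<close>, the limit allowed by \<open>inverse_perturbation\<close>; the
    resulting error \<open>2 * c\<^sup>2 * r w\<close> is \<open>c\<close> itself.\<close>
  define r where "r w = 1 / (2 * (norm (R w) + 1))" for w
  have r0: "r w > 0" for w unfolding r_def by (intro divide_pos_pos) (auto intro: add_nonneg_pos)
  have cover: "sphere (0::complex) 1 \<subseteq> (\<Union>w\<in>sphere 0 1. ball w (r w))"
    using r0 by (auto intro!: bexI)
  obtain W where W: "W \<subseteq> sphere 0 1" "finite W" "sphere (0::complex) 1 \<subseteq> (\<Union>w\<in>W. ball w (r w))"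
    using compactE_image[OF compact_sphere _ cover] by (metis open_ball)
  define C where "C = 1 + (\<Sum>w\<in>W. 2 * norm (R w) + 1)"
  have "\<exists>b. inverse_pair (1 - w *\<^sub>C u) b \<and> norm b \<le> C" if w: "cmod w = 1" for w
  proof -
    obtain v where v: "v \<in> W" "dist v w < r v" using W(3) w by auto
    define c where "c = norm (R v) + 1"
    have c: "c \<ge> 1" by (simp add: c_def)
    have "cmod v = 1" using W(1) v(1) by auto
    then have Rv: "inverse_pair (1 - v *\<^sub>C u) (R v)" by (rule R)
    have "norm ((1 - w *\<^sub>C u) - (1 - v *\<^sub>C u)) = dist v w * norm u"
      by (simp add: dist_norm norm_scaleC flip: cvs.scale_left_diff_distrib)
    also have "\<dots> \<le> dist v w * 1" using u by (intro mult_left_mono) auto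
    finally have "norm ((1 - w *\<^sub>C u) - (1 - v *\<^sub>C u)) \<le> r v" using v(2) by simp
    moreover have rc: "c * r v = 1 / 2" using c by (simp add: r_def flip: c_def)
    ultimately obtain b' where b': "inverse_pair (1 - w *\<^sub>C u) b'"
      "norm (b' - R v) \<le> 2 * c\<^sup>2 * r v"
      using inverse_perturbation[OF Rv, of c "1 - w *\<^sub>C u" "r v"] by (auto simp: c_def)
    have "2 * c\<^sup>2 * r v = c" using rc by (simp add: power2_eq_square)
    then have "norm b' \<le> 2 * norm (R v) + 1"
      using b'(2) norm_triangle_sub[of b' "R v"] by (simp add: c_def)
    also have "\<dots> \<le> (\<Sum>w\<in>W. 2 * norm (R w) + 1)"
      using v(1) W(2) by (intro member_le_sum) auto
    finally show ?thesis using b'(1) by (auto simp: C_def)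
  qed
  moreover have "1 \<le> C" unfolding C_def by (simp add: sum_nonneg)
  ultimately show thesis using that by blast
qed

text \<open>Averaging the resolvents at \<open>v\<close> and \<open>- v\<close> gives the resolvent of \<open>u\<^sup>2\<close> at \<open>v\<^sup>2\<close>,
  so the modulus of continuity does not deteriorate under squaring.\<close>
lemma resolvent_square:
  fixes u :: "'a :: unital_cstar_algebra"
  assumes R: "\<And>w. cmod w = 1 \<Longrightarrow> \<exists>b b'. inverse_pair (1 - w *\<^sub>C u) b
      \<and> inverse_pair (1 - (complex_of_real t * w) *\<^sub>C u) b' \<and> norm (b - b') \<le> \<epsilon>"
    and w: "cmod w = 1"
  shows "\<exists>b b'. inverse_pair (1 - w *\<^sub>C u\<^sup>2) b
      \<and> inverse_pair (1 - (complex_of_real (t\<^sup>2) * w) *\<^sub>C u\<^sup>2) b' \<and> norm (b - b') \<le> \<epsilon>"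
proof -
  \<comment> \<open>This is \<open>1/(1 - s) + 1/(1 + s) = 2/(1 - s\<^sup>2)\<close> with
    \<open>s = v *\<^sub>C u\<close>: the factors \<open>p\<close> and \<open>q\<close> commute and
    add up to 2.\<close>
  have avg: "inverse_pair (1 - (v * v) *\<^sub>C u\<^sup>2) ((1/2) *\<^sub>C (b + c))"
    if b: "inverse_pair (1 - v *\<^sub>C u) b" and c: "inverse_pair (1 - (- v) *\<^sub>C u) c" for v b c
  proof -
    define p where "p = 1 - v *\<^sub>C u"
    define q where "q = 1 - (- v) *\<^sub>C u"
    have pq: "p * q = 1 - (v * v) *\<^sub>C u\<^sup>2" "q * p = 1 - (v * v) *\<^sub>C u\<^sup>2"
      by (simp_all add: p_def q_def algebra_simps mult_scaleC_left mult_scaleC_right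
          scaleC_scaleC power2_eq_square)
    have sum: "p + q = 2 *\<^sub>C 1"
      using scaleC_add_left[of 1 1 "1::'a"] by (simp add: p_def q_def)
    have inv: "p * b = 1" "b * p = 1" "q * c = 1" "c * q = 1"
      using b c by (auto simp: inverse_pair_def p_def q_def)
    have "p * q * (b + c) = q * (p * b) + p * (q * c)"
      by (simp add: distrib_left pq mult.assoc[symmetric])
    also have "\<dots> = 2 *\<^sub>C 1" using sum by (simp add: inv add.commute)
    finally have 1: "p * q * (b + c) = 2 *\<^sub>C 1" .
    have "(b + c) * (p * q) = (b * p) * q + (c * q) * p"
      by (simp add: distrib_right pq(1) mult.assoc) (simp add: pq)
    also have "\<dots> = 2 *\<^sub>C 1" using sum by (simp add: inv add.commute)
    finally have 2: "(b + c) * (p * q) = 2 *\<^sub>C 1" .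
    show ?thesis
      unfolding inverse_pair_def pq(1)[symmetric]
      by (simp add: mult_scaleC_left mult_scaleC_right 1 2 scaleC_scaleC)
  qed
  define v where "v = csqrt w"
  have v2: "v * v = w" by (simp add: v_def flip: power2_eq_square)
  have v1: "cmod v = 1" using w by (simp add: v_def)
  obtain b b' where b: "inverse_pair (1 - v *\<^sub>C u) b"
    "inverse_pair (1 - (complex_of_real t * v) *\<^sub>C u) b'" "norm (b - b') \<le> \<epsilon>"
    using R[OF v1] by blast
  obtain c c' where c: "inverse_pair (1 - (- v) *\<^sub>C u) c"
    "inverse_pair (1 - (- (complex_of_real t * v)) *\<^sub>C u) c'" "norm (c - c') \<le> \<epsilon>"
    using R[of "- v"] v1 by auto
  have "(1/2) *\<^sub>C (b + c) - (1/2) *\<^sub>C (b' + c') = (1/2) *\<^sub>C ((b - b') + (c - c'))"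
    by (simp add: scaleC_add_right cvs.scale_right_diff_distrib)
  then have "norm ((1/2) *\<^sub>C (b + c) - (1/2) *\<^sub>C (b' + c')) = norm ((b - b') + (c - c')) / 2"
    by (simp add: norm_scaleC)
  also have "\<dots> \<le> \<epsilon>" using norm_triangle_mono[OF b(3) c(3)] by simp
  finally have "norm ((1/2) *\<^sub>C (b + c) - (1/2) *\<^sub>C (b' + c')) \<le> \<epsilon>" .
  moreover have "complex_of_real t * v * (complex_of_real t * v) = complex_of_real (t\<^sup>2) * w"
    by (simp add: power2_eq_square v2[symmetric] mult_ac)
  ultimately show ?thesis
    using avg[OF b(1) c(1)] avg[OF b(2) c(2)] v2 by metis
qed

text \<open>Iterating \<open>resolvent_square\<close> keeps the same \<open>\<epsilon>\<close> for
  all \<open>m\<close>, while the factor \<open>t\<close> is raised to the power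
  \<open>2 ^ m\<close>.\<close>

lemma resolvent_power_two:
  fixes u :: "'a :: unital_cstar_algebra"
  assumes "\<And>w. cmod w = 1 \<Longrightarrow> \<exists>b b'. inverse_pair (1 - w *\<^sub>C u) b
      \<and> inverse_pair (1 - (complex_of_real t * w) *\<^sub>C u) b' \<and> norm (b - b') \<le> \<epsilon>"
    and "cmod w = 1"
  shows "\<exists>b b'. inverse_pair (1 - w *\<^sub>C u ^ (2 ^ m)) b
      \<and> inverse_pair (1 - (complex_of_real (t ^ (2 ^ m)) * w) *\<^sub>C u ^ (2 ^ m)) b'
      \<and> norm (b - b') \<le> \<epsilon>"
  using assms(2)
proof (induction m arbitrary: w)
  case 0
  then show ?case using assms(1) by simp
next
  case (Suc m)
  show ?case
    using resolvent_square[of "u ^ (2 ^ m)" "t ^ (2 ^ m)", OF Suc.IH Suc.prems]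
    by (simp add: mult.commute flip: power_mult)
qed

lemma selfadjoint_norm_power_two:
  fixes u :: "'a :: unital_cstar_algebra"
  assumes "adj u = u"
  shows "norm (u ^ (2 ^ m)) = norm u ^ (2 ^ m)"
proof -
  have sa: "adj (u ^ n) = u ^ n" for n
    by (induction n) (simp_all add: adj_mult assms power_commutes)
  show ?thesis
  proof (induction m)
    case (Suc m)
    have "norm (u ^ (2 ^ Suc m)) = norm (adj (u ^ (2 ^ m)) * u ^ (2 ^ m))"
      by (simp add: sa mult_2 power_add)
    then show ?case
      by (simp add: cstar_identity Suc mult.commute flip: power_mult)
  qed simp
qed

text \<open>If all resolvents existed on the unit circle, then those of \<open>p = u ^ 2 ^ N\<close> at \<open>1\<close> and at \<open>T = t ^ 2 ^ N\<close>
  would be uniformly close. The latter tends to \<open>1\<close> as \<open>N\<close> grows, so the former would be near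
  \<open>1\<close>, forcing \<open>norm p < 1\<close>.\<close>
lemma selfadjoint_unit_resolvent_singular:
  fixes u :: "'a :: unital_cstar_algebra"
  assumes sa: "adj u = u" and u: "norm u = 1"
  shows "\<exists>w. cmod w = 1 \<and> \<not> (\<exists>b. inverse_pair (1 - w *\<^sub>C u) b)"
proof (rule ccontr)
  assume "\<not> ?thesis"
  then obtain C where C: "1 \<le> C"
    "\<And>w. cmod w = 1 \<Longrightarrow> \<exists>b. inverse_pair (1 - w *\<^sub>C u) b \<and> norm b \<le> C"
    using resolvent_bounded_on_circle[of u] u by auto
  \<comment> \<open>Chosen so that the perturbation error \<open>2 * C\<^sup>2 * \<delta>\<close>
    equals 1/8; \<open>C * \<delta> \<le> 1 / 2\<close> then follows from
    \<open>1 \<le> C\<close>.\<close>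
  define \<delta> where "\<delta> = 1 / (16 * C\<^sup>2)"
  define t where "t = 1 - \<delta>"
  have C2: "C \<le> C\<^sup>2" using C(1) by (simp add: power2_eq_square)
  have "C \<noteq> 0" "1 \<le> C\<^sup>2" using C(1) C2 by linarith+
  then have d0: "0 < \<delta>" "\<delta> \<le> 1" "C * \<delta> \<le> 1 / 2" "2 * C\<^sup>2 * \<delta> \<le> 1 / 8"
    using C2 unfolding \<delta>_def by (simp_all add: divide_simps)
  have close: "\<exists>b b'. inverse_pair (1 - w *\<^sub>C u) b
      \<and> inverse_pair (1 - (complex_of_real t * w) *\<^sub>C u) b' \<and> norm (b - b') \<le> 1 / 8"
    if w: "cmod w = 1" for w
  proof -
    obtain b where b: "inverse_pair (1 - w *\<^sub>C u) b" "norm b \<le> C" using C(2)[OF w] by blast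
    have "(1 - (complex_of_real t * w) *\<^sub>C u) - (1 - w *\<^sub>C u)
        = (w - complex_of_real t * w) *\<^sub>C u"
      by (simp add: cvs.scale_left_diff_distrib)
    also have "w - complex_of_real t * w = complex_of_real \<delta> * w"
      by (simp add: t_def algebra_simps)
    finally have "norm ((1 - (complex_of_real t * w) *\<^sub>C u) - (1 - w *\<^sub>C u)) \<le> \<delta>"
      using d0 by (simp add: norm_scaleC norm_mult w u)
    then obtain b' where "inverse_pair (1 - (complex_of_real t * w) *\<^sub>C u) b'"
      "norm (b' - b) \<le> 2 * C\<^sup>2 * \<delta>"
      using inverse_perturbation[OF b _ d0(3)] by blast
    then show ?thesis using b(1) d0(4) by (metis norm_minus_commute order_trans)
  qed
  have "(\<lambda>n. t ^ n) \<longlonglongrightarrow> 0"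
    using d0 by (intro LIMSEQ_realpow_zero) (auto simp: t_def)
  then have "eventually (\<lambda>n. t ^ n < 1 / 8) sequentially"
    by (rule order_tendstoD) simp
  then obtain N where N: "\<And>n. n \<ge> N \<Longrightarrow> t ^ n < 1 / 8"
    unfolding eventually_sequentially by blast
  define T where "T = t ^ (2 ^ N)"
  define p where "p = u ^ (2 ^ N)"
  define q where "q = complex_of_real T *\<^sub>C p"
  have T: "0 \<le> T" "T < 1 / 8"
    using N[of "2 ^ N"] d0 by (auto simp: T_def t_def)
  have np: "norm p = 1" unfolding p_def using selfadjoint_norm_power_two[OF sa] u by simp
  have nq: "norm q < 1 / 8" using T by (simp add: q_def norm_scaleC np)
  obtain b b' where b: "inverse_pair (1 - p) b" and b': "inverse_pair (1 - q) b'"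
    and bb: "norm (b - b') \<le> 1 / 8"
    using resolvent_power_two[where u = u and t = t and \<epsilon> = "1/8" and w = 1 and m = N, OF close]
    by (auto simp: p_def q_def T_def)
  have e': "b' - 1 = b' * q" and e: "b - 1 = b * p"
    using b b' by (simp_all add: inverse_pair_def algebra_simps)
  \<comment> \<open>With \<open>s = norm (b' - 1)\<close>, the two bounds give
    \<open>s \<le> (1 + s) / 8\<close>, so \<open>s \<le> 1/7\<close>; and 1/7 + 1/8 < 1/3.\<close>
  have "norm (b' - 1) \<le> norm b' * (1 / 8)"
    unfolding e' using nq by (intro order_trans[OF norm_mult_ineq] mult_left_mono) auto
  moreover have "norm b' \<le> 1 + norm (b' - 1)"
    using norm_triangle_sub[of b' 1] by simp
  ultimately have "norm (b' - 1) \<le> 1 / 7" by simp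
  then have b1: "norm (b - 1) < 1 / 3"
    using norm_triangle_mono[OF bb, of "b' - 1" "1 / 7"] by simp
  \<comment> \<open>Since \<open>b * p = b - 1\<close> and \<open>norm p = 1\<close>, this yields
    \<open>norm p \<le> 2 * norm (b - 1) < 2/3\<close>, a contradiction.\<close>
  have "p = b * p - (b - 1) * p" by (simp add: algebra_simps)
  then have "norm p \<le> norm (b * p) + norm ((b - 1) * p)"
    by (metis norm_triangle_ineq4)
  also have "\<dots> \<le> norm (b - 1) + norm (b - 1) * norm p"
    unfolding e[symmetric] by (intro add_left_mono norm_mult_ineq)
  finally show False using b1 np by simp
qed

lemma selfadjoint_norm_in_spectrum:
  fixes h :: "'a :: unital_cstar_algebra"
  assumes sa: "adj h = h"
  obtains z where "z \<in> spectrum_in UNIV h" "cmod z = norm h"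
proof (cases "h = 0")
  case True
  then show thesis by (intro that[of 0]) (auto simp: spectrum_in_def)
next
  case False
  define s where "s = complex_of_real (norm h)"
  have s: "s \<noteq> 0" "cmod s = norm h" "cnj (inverse s) = inverse s"
    using False by (auto simp: s_def)
  obtain w where w: "cmod w = 1"
    and sing: "\<not> (\<exists>b. inverse_pair (1 - w *\<^sub>C (inverse s *\<^sub>C h)) b)"
    using selfadjoint_unit_resolvent_singular[of "inverse s *\<^sub>C h"] False s
    by (auto simp: adj_scaleC sa norm_scaleC norm_inverse)
  have w0: "w \<noteq> 0" using w by auto
  have "s / w \<in> spectrum_in UNIV h"
  proof (rule ccontr)
    assume "s / w \<notin> spectrum_in UNIV h"
    then obtain b where b: "inverse_pair (h - (s / w) *\<^sub>C 1) b"
      unfolding notin_spectrum_in_iff by blast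
    have "- (w / s) *\<^sub>C (h - (s / w) *\<^sub>C 1) = 1 - w *\<^sub>C (inverse s *\<^sub>C h)"
    proof -
      have "w / s * (s / w) = 1" using s w0 by simp
      then show ?thesis
        by (simp add: cvs.scale_right_diff_distrib scaleC_scaleC inverse_eq_divide)
    qed
    then show False
      using inverse_pair_scaleC[OF b, of "- (w / s)"] s w0 sing by auto
  qed
  then show thesis
    using s w by (intro that[of "s / w"]) (auto simp: norm_divide)
qed

text \<open>Some spectral value \<open>z\<close> of \<open>1 - g\<close> has modulus
  \<open>norm (1 - g)\<close>. Positivity of \<open>1 - g\<close> gives \<open>0 \<le> z\<close>,
  and positivity of \<open>g\<close>, which has the spectral value \<open>1 - z\<close>, gives
  \<open>z \<le> 1\<close>.\<close>

lemma norm_one_minus_contraction_le: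
  assumes B: "unital_cstar_subalgebra B"
    and g: "g \<in> positives B" and h: "1 - g \<in> positives B"
  shows "norm (1 - g) \<le> 1"
proof -
  have "adj (1 - g) = 1 - g" using h by (simp add: positives_def)
  then obtain z where z: "z \<in> spectrum_in UNIV (1 - g)" "cmod z = norm (1 - g)"
    by (rule selfadjoint_norm_in_spectrum)
  \<comment> \<open>An inverse in \<open>B\<close> is also one in the whole algebra, so passing to
    \<open>B\<close> can only enlarge the spectrum.\<close>
  have zB: "z \<in> spectrum_in B (1 - g)" using z(1) by (auto simp: spectrum_in_def)
  have "1 - z \<in> spectrum_in B g"
  proof (rule ccontr)
    assume "1 - z \<notin> spectrum_in B g"
    then obtain b where b: "b \<in> B" "inverse_pair (g - (1 - z) *\<^sub>C 1) b"
      unfolding notin_spectrum_in_iff by blast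
    have "inverse_pair ((1 - g) - z *\<^sub>C 1) (0 - b)"
      using b(2) by (simp add: inverse_pair_def cvs.scale_left_diff_distrib algebra_simps)
    then show False
      using zB b(1) subalgebra_closed(3,5)[OF B] notin_spectrum_in_iff by blast
  qed
  then have "z \<in> \<real>" "0 \<le> Re z" "Re z \<le> 1"
    using g h zB by (auto simp: positives_def)
  then show ?thesis using z(2) by (auto elim!: Reals_cases)
qed

section \<open>Ideals and large subalgebras\<close>

text \<open>With sums indexed by lists of pairs, addition is concatenation and multiplication acts
  entrywise. Limits carry both over to the closure, and scalars act as multiples of
  \<open>1\<close>.\<close>

lemma closure_sandwich_ideal:
  fixes y :: "'a :: unital_cstar_algebra"
  shows "closed_ideal UNIV (closure (range (\<lambda>l. \<Sum>(p, q)\<leftarrow>l. p * y * q)))"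
proof -
  define f where "f l = (\<Sum>(p, q)\<leftarrow>l. p * y * q)" for l
  have add: "f k + f l = f (k @ l)" for k l by (simp add: f_def)
  have left: "d * f l = f (map (\<lambda>(p, q). (d * p, q)) l)" for d l
    by (induction l) (auto simp: f_def distrib_left mult.assoc)
  have right: "f l * d = f (map (\<lambda>(p, q). (p, q * d)) l)" for d l
    by (induction l) (auto simp: f_def distrib_right mult.assoc)
  have in_closure: "x \<in> closure (range f)" if "\<And>n. s n \<in> range f" "s \<longlonglongrightarrow> x"
    for s :: "nat \<Rightarrow> 'a" and x
    unfolding closure_sequential using that by blast
  have ideal: "d * x \<in> closure (range f)" "x * d \<in> closure (range f)"
    if x: "x \<in> closure (range f)" for x d
  proof -
    obtain s where s: "\<And>n. s n \<in> range f" "s \<longlonglongrightarrow> x"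
      using x unfolding closure_sequential by blast
    have mem: "\<And>n. d * s n \<in> range f" "\<And>n. s n * d \<in> range f"
      using s(1) left right by (metis rangeE rangeI)+
    show "d * x \<in> closure (range f)"
      using mem(1) tendsto_mult_left[OF s(2)] by (rule in_closure)
    show "x * d \<in> closure (range f)"
      using mem(2) tendsto_mult_right[OF s(2)] by (rule in_closure)
  qed
  have "0 \<in> range f" by (rule range_eqI[of _ _ "[]"]) (simp add: f_def)
  then have zero: "0 \<in> closure (range f)" by (rule subsetD[OF closure_subset])
  have plus: "x + x' \<in> closure (range f)"
    if x: "x \<in> closure (range f)" "x' \<in> closure (range f)" for x x'
  proof -
    obtain s s' where s: "\<And>n. s n \<in> range f" "s \<longlonglongrightarrow> x" "\<And>n. s' n \<in> range f" "s' \<longlonglongrightarrow> x'"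
      using x unfolding closure_sequential by blast
    have "\<And>n. s n + s' n \<in> range f"
      using s(1,3) add by (metis rangeE rangeI)
    moreover have "(\<lambda>n. s n + s' n) \<longlonglongrightarrow> x + x'"
      using s(2,4) by (rule tendsto_add)
    ultimately show ?thesis by (rule in_closure)
  qed
  have scale: "c *\<^sub>C x \<in> closure (range f)" if "x \<in> closure (range f)" for c x
    using ideal(1)[OF that, of "c *\<^sub>C 1"] by (simp add: mult_scaleC_left)
  show ?thesis
    unfolding closed_ideal_def f_def[symmetric] using zero plus scale ideal
    by (auto intro!: cvs.subspaceI)
qed

lemma simple_unit_approx:
  fixes y :: "'a :: unital_cstar_algebra"
  assumes simple: "simple_cstar (UNIV :: 'a set)" and y: "y \<noteq> 0" and e: "\<epsilon> > 0"
  obtains l where "norm (1 - (\<Sum>(p, q)\<leftarrow>l. p * y * q)) < \<epsilon>"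
proof -
  let ?f = "\<lambda>l. \<Sum>(p, q)\<leftarrow>l. p * y * q"
  have "y \<in> range ?f" by (rule range_eqI[of _ _ "[(1, 1)]"]) simp
  then have "y \<in> closure (range ?f)" by (rule subsetD[OF closure_subset])
  then have "closure (range ?f) = UNIV"
    using simple closure_sandwich_ideal[of y] y unfolding simple_cstar_def by blast
  then have "1 \<in> closure (range ?f)" by blast
  then obtain z where "z \<in> range ?f" "dist z 1 < \<epsilon>"
    unfolding closure_approachable using e by blast
  then show thesis using that by (auto simp: dist_norm norm_minus_commute)
qed

text \<open>Restates largeness, with \<open>x = 1\<close>, for a finite set in place of an indexed
  tuple, so that the approximants form a function \<open>c\<close> on elements.\<close>

lemma large_subalgebra_approx:
  fixes B :: "'a :: unital_cstar_algebra set"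
  assumes large: "large_subalgebra B" and S: "finite S" and e: "\<epsilon> > 0"
    and y: "y \<in> positives B" "y \<noteq> 0"
  obtains c g where "g \<in> positives B" "1 - g \<in> positives B" "cuntz_subeq B g y"
    "\<And>a. a \<in> S \<Longrightarrow> norm (c a - a) < \<epsilon>" "\<And>a. a \<in> S \<Longrightarrow> (1 - g) * c a \<in> B"
proof -
  \<comment> \<open>Inserting \<open>1\<close> guarantees \<open>m \<ge> 1\<close> even for empty
    \<open>S\<close>.\<close>
  define m where "m = card (insert 1 S)"
  have m: "m \<ge> 1" using S by (simp add: m_def card_gt_0_iff Suc_le_eq)
  obtain e where e_bij: "bij_betw e {1..m} (insert 1 S)"
    unfolding m_def using ex_bij_betw_nat_finite_1[of "insert 1 S"] S by auto
  obtain i where i: "\<And>a. a \<in> S \<Longrightarrow> i a \<in> {1..m}" "\<And>a. a \<in> S \<Longrightarrow> e (i a) = a"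
    using bij_betw_inv_into_right[OF e_bij] bij_betwE[OF bij_betw_inv_into[OF e_bij]]
    by (metis insertI2)
  have "1 \<in> positives UNIV" by (rule one_in_positives[OF unital_cstar_subalgebra_UNIV])
  then obtain c g where "g \<in> positives B" "1 - g \<in> positives B" "cuntz_subeq B g y"
    "\<forall>j\<in>{1..m}. norm (c j - e j) < \<epsilon>" "\<forall>j\<in>{1..m}. (1 - g) * c j \<in> B"
    using large m \<open>\<epsilon> > 0\<close> y norm_one unfolding large_subalgebra_def by blast
  then show thesis
    using i by (intro that[of g "c \<circ> i"]) fastforce+
qed

theorem proposition5p2:
  fixes B :: "'a :: unital_cstar_algebra set"
  assumes "\<not> finite_dimensional (UNIV :: 'a set)"
    and "simple_cstar (UNIV :: 'a set)"
    and "large_subalgebra B"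
  shows "simple_cstar B"
proof -
  have B: "unital_cstar_subalgebra B"
    using assms(3) by (simp add: large_subalgebra_def)
  note B_closed = subalgebra_closed[OF B]
  have "I = B" if I: "closed_ideal B I" and nz: "I \<noteq> {0}" for I
  proof -
    have I_closed: "closed I" "I \<subseteq> B" "0 \<in> I" and I_sub: "cvs.subspace I"
      and I_mult: "\<And>d x. d \<in> B \<Longrightarrow> x \<in> I \<Longrightarrow> d * x \<in> I" "\<And>d x. d \<in> B \<Longrightarrow> x \<in> I \<Longrightarrow> x * d \<in> I"
      using I by (auto simp: closed_ideal_def cvs.subspace_0)
    obtain b where b: "b \<in> I" "b \<noteq> 0" using nz I_closed(3) by blast
    \<comment> \<open>Squares of self-adjoint elements are easily seen to be positive, whereas positivity of
      \<open>adj b * b\<close> itself is a harder theorem; hence the choice of \<open>y\<close>.\<close>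
    define k where "k = adj b * b"
    define y where "y = k * k"
    have "k \<in> I" using b(1) I_closed(2) I_mult(1) B_closed(8) by (auto simp: k_def)
    then have k: "k \<in> I" "k \<in> B" "adj k = k" and "k \<noteq> 0"
      using b(2) I_closed(2) cstar_identity[of b] by (auto simp: k_def adj_mult adj_adj)
    have y: "y \<in> I" "y \<in> positives B"
      using k I_mult(1) square_in_positives[OF B] by (auto simp: y_def)
    have y0: "y \<noteq> 0"
      using cstar_identity[of k] k(3) \<open>k \<noteq> 0\<close> by (auto simp: y_def)
    have g_in_I: "g \<in> I" if g: "cuntz_subeq B g y" for g
    proof -
      obtain v where v: "\<forall>n. v n \<in> B" "(\<lambda>n. v n * y * adj (v n)) \<longlonglongrightarrow> g"
        using g unfolding cuntz_subeq_def by blast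
      have "v n * y * adj (v n) \<in> I" for n
        using v(1) I_mult B_closed(8) y(1) by simp
      then show ?thesis
        using v(2) by (rule closed_sequentially[OF I_closed(1)])
    qed
    have "\<exists>x\<in>I. dist x 1 < \<epsilon>" if e: "\<epsilon> > 0" for \<epsilon>
    proof -
      obtain l where l: "norm (1 - (\<Sum>(p, q)\<leftarrow>l. p * y * q)) < \<epsilon>"
        using simple_unit_approx[OF assms(2) y0 e] by blast
      \<comment> \<open>Right factors enter through their adjoints: \<open>h * c (adj q)\<close> in
        \<open>B\<close> gives \<open>adj (c (adj q)) * h\<close> in \<open>B\<close> once
        \<open>h\<close> is self-adjoint.\<close>
      define S where "S = fst ` set l \<union> (adj \<circ> snd) ` set l"
      have "finite S" by (simp add: S_def)
      \<comment> \<open>The list \<open>l\<close> is fixed first; letting the tolerance tend to 0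
        replaces an explicit estimate by continuity of the finite sum.\<close>
      then have "\<exists>c g. g \<in> positives B \<and> 1 - g \<in> positives B \<and> cuntz_subeq B g y \<and>
          (\<forall>a\<in>S. norm (c a - a) < inverse (real (Suc n)) \<and> (1 - g) * c a \<in> B)" for n
        by (rule large_subalgebra_approx[OF assms(3) _ _ y(2) y0, of S "inverse (real (Suc n))"])
          auto
      then obtain c g where g: "\<And>n. g n \<in> positives B" "\<And>n. 1 - g n \<in> positives B"
          "\<And>n. cuntz_subeq B (g n) y"
        and c: "\<And>n a. a \<in> S \<Longrightarrow> norm (c n a - a) < inverse (real (Suc n))"
          "\<And>n a. a \<in> S \<Longrightarrow> (1 - g n) * c n a \<in> B"
        by metis
      have c_lim: "(\<lambda>n. c n a) \<longlonglongrightarrow> a" if "a \<in> S" for a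
      proof (rule LIM_zero_cancel[OF Lim_null_comparison[OF _ LIMSEQ_inverse_real_of_nat]])
        show "\<forall>\<^sub>F n in sequentially. norm (c n a - a) \<le> inverse (real (Suc n))"
          using c(1)[OF that] by (intro always_eventually allI less_imp_le)
      qed
      define z where "z n = (\<Sum>(p, q)\<leftarrow>l. c n p * y * adj (c n (adj q)))" for n
      have "(\<lambda>n. \<Sum>(p, q)\<leftarrow>k. c n p * y * adj (c n (adj q))) \<longlonglongrightarrow> (\<Sum>(p, q)\<leftarrow>k. p * y * q)"
        if "set k \<subseteq> set l" for k
        using that
      proof (induction k)
        case (Cons pq k)
        obtain p q where pq: "pq = (p, q)" by (cases pq)
        have S: "p \<in> S" "adj q \<in> S" using Cons.prems pq by (force simp: S_def)+
        have "(\<lambda>n. c n p * y * adj (c n (adj q))) \<longlonglongrightarrow> p * y * q"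
          using tendsto_mult[OF tendsto_mult[OF c_lim[OF S(1)] tendsto_const]
              tendsto_adj[OF c_lim[OF S(2)]]] by (simp add: adj_adj)
        then show ?case using Cons pq by (auto intro: tendsto_add)
      qed simp
      then have "(\<lambda>n. norm (1 - z n)) \<longlonglongrightarrow> norm (1 - (\<Sum>(p, q)\<leftarrow>l. p * y * q))"
        unfolding z_def by (intro tendsto_intros) simp
      then have "eventually (\<lambda>n. norm (1 - z n) < \<epsilon>) sequentially"
        using l by (rule order_tendstoD)
      then obtain n where n: "norm (1 - z n) < \<epsilon>"
        using eventually_happens sequentially_bot by blast
      define h where "h = 1 - g n"
      have gI: "g n \<in> I" using g(3) by (rule g_in_I)
      have h: "h \<in> B" "adj h = h" "norm h \<le> 1"
        using g(2)[of n] norm_one_minus_contraction_le[OF B g(1,2)] by (auto simp: h_def positives_def)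
      have "(\<Sum>(p, q)\<leftarrow>k. h * (c n p * y * adj (c n (adj q))) * h) \<in> I" if "set k \<subseteq> set l" for k
        using that
      proof (induction k)
        case Nil
        then show ?case using I_closed(3) by simp
      next
        case (Cons pq k)
        obtain p q where pq: "pq = (p, q)" by (cases pq)
        have S: "p \<in> S" "adj q \<in> S" using Cons.prems pq by (force simp: S_def)+
        \<comment> \<open>Regrouping shows each summand as an element of \<open>B\<close>, times
          \<open>y\<close> in \<open>I\<close>, times an element of \<open>B\<close>.\<close>
        have "h * (c n p * y * adj (c n (adj q))) * h
            = (h * c n p) * y * adj (h * c n (adj q))"
          by (simp add: adj_mult h mult.assoc)
        also have "\<dots> \<in> I"
          using c(2)[OF S(1), of n] c(2)[OF S(2), of n] y(1) I_mult B_closed(8)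
          by (simp add: h_def)
        finally show ?case using Cons pq cvs.subspace_add[OF I_sub] by auto
      qed
      then have "(\<Sum>(p, q)\<leftarrow>l. h * (c n p * y * adj (c n (adj q))) * h) \<in> I" by blast
      moreover have "(\<Sum>(p, q)\<leftarrow>k. h * (c n p * y * adj (c n (adj q))) * h)
          = h * (\<Sum>(p, q)\<leftarrow>k. c n p * y * adj (c n (adj q))) * h" for k
        by (induction k) (auto simp: distrib_left distrib_right)
      ultimately have "h * z n * h \<in> I" by (simp add: z_def)
      moreover have "g n + g n * h \<in> I"
        using gI h(1) I_mult(2) cvs.subspace_add[OF I_sub] by blast
      ultimately have "g n + g n * h + h * z n * h \<in> I"
        using cvs.subspace_add[OF I_sub] by blast
      \<comment> \<open>As \<open>g n = 1 - h\<close>, the first two terms are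
        \<open>1 - h * h\<close>, so the difference from \<open>1\<close> is
        \<open>h * (1 - z n) * h\<close>.\<close>
      moreover have "dist (g n + g n * h + h * z n * h) 1 = norm (h * (1 - z n) * h)"
        by (subst dist_commute) (simp add: dist_norm h_def algebra_simps)
      moreover have "norm (h * (1 - z n) * h) \<le> norm (1 - z n)"
      proof -
        have "norm (h * (1 - z n) * h) \<le> norm h * norm (1 - z n) * norm h"
          by (metis norm_mult_ineq mult_right_mono norm_ge_zero order_trans)
        also have "\<dots> \<le> 1 * norm (1 - z n) * 1"
          using h(3) by (intro mult_mono) auto
        finally show ?thesis by simp
      qed
      ultimately show ?thesis using n by force
    qed
    then have "1 \<in> closure I" by (simp add: closure_approachable)
    then have "1 \<in> I" using I_closed(1) by simp
    then show "I = B" using I_mult(1) I_closed(2) by fastforce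
  qed
  moreover have "B \<noteq> {0}" using B_closed(2) by auto
  ultimately show ?thesis unfolding simple_cstar_def by blast
qed

end
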